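(* Let $\boldsymbol{A}\in\mathbb{R}^{3\times3}$ be composed of columns $\boldsymbol{a}_1,\boldsymbol{a}_2,\boldsymbol{a}_3$, and assume that $\boldsymbol{a}_2$ and $\boldsymbol{a}_3$ are in counterclockwise order with respect to the direction $\boldsymbol{a}_1$. Let $$\sigma=\frac{|\boldsymbol{a}_1\cdot(\boldsymbol{a}_2\times\boldsymbol{a}_3)|}{\Vert\boldsymbol{a}_1\Vert\Vert\boldsymbol{a}_2\Vert\Vert\boldsymbol{a}_3\Vert},$$ and assume $\sigma\gg\epsilon_{\text{machine}}$. Then the absolute error of the triple product computed in floating-point arithmetic with machine precision $\epsilon_{\text{machine}}$ is bounded in the sense that $$\left|\boldsymbol{a}_1\cdot(\boldsymbol{a}_2\times\boldsymbol{a}_3)-\boldsymbol{a}_1\odot(\boldsymbol{a}_2\otimes\boldsymbol{a}_3)\right|=\frac{\det(\boldsymbol{A})}{\sigma}\,\mathcal{O}(\epsilon_{\text{machine}}).$$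
   Context: $\Vert\cdot\Vert$ is the Euclidean norm on $\mathbb{R}^3$. Counterclockwise order of $\boldsymbol{a}_2,\boldsymbol{a}_3$ with respect to $\boldsymbol{a}_1$ means $\det(\boldsymbol{A})=\boldsymbol{a}_1\cdot(\boldsymbol{a}_2\times\boldsymbol{a}_3)>0$. Floating-point model: there is a rounding map $\mathrm{fl}:\mathbb{R}\to\mathbb{R}$ with $|\mathrm{fl}(x)-x|\le\epsilon_{\text{machine}}|x|$ for all real $x$, and each basic arithmetic operation $*\in\{+,-,\times\}$ is replaced by a floating-point operation $\circledast$ on floating-point numbers $x,y$ satisfying $|x\circledast y-x*y|\le\epsilon_{\text{machine}}|x*y|$ (overflow and underflow are ignored). Real inputs are first rounded by $\mathrm{fl}$. $\otimes$ and $\odot$ denote the cross product and the inner product evaluated in this floating-point arithmetic: $\boldsymbol{b}\otimes\boldsymbol{c}$ evaluates $(b_2c_3-b_3c_2,\ b_3c_1-b_1c_3,\ b_1c_2-b_2c_1)$ with each of the two products and the subtraction in each component rounded, and $\boldsymbol{a}\odot\boldsymbol{v}$ evaluates $(a_1v_1+a_2v_2)+a_3v_3$ in that order with each product and sum rounded. The hypothesis $\sigma\gg\epsilon_{\text{machine}}$ and the notation $\mathcal{O}(\epsilon_{\text{machine}})$ mean: there are absolute constants $K,C>0$, independent of $\boldsymbol{A}$ and $\epsilon_{\text{machine}}$, such that whenever $\sigma\ge K\epsilon_{\text{machine}}$ the left-hand side is at most $C\,\frac{\det(\boldsymbol{A})}{\sigma}\,\epsilon_{\text{machine}}$. *)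

theory Defs
  imports "HOL-Analysis.Analysis"
begin

(* F is the set of floating-point numbers.  Neither overflow nor underflow is modelled, and
   nothing is required of the operations outside F.  The case x = 1 of the rounding bound
   forces eps to be nonnegative. *)
locale fp_arithmetic =
  fixes eps :: real
    and F :: "real set"
    and fl :: "real \<Rightarrow> real"
    and fadd fsub fmul :: "real \<Rightarrow> real \<Rightarrow> real"
  assumes fl_in: "fl x \<in> F"
    and fl_error: "\<bar>fl x - x\<bar> \<le> eps * \<bar>x\<bar>"
    and fadd_in: "\<lbrakk>x \<in> F; y \<in> F\<rbrakk> \<Longrightarrow> fadd x y \<in> F"
    and fsub_in: "\<lbrakk>x \<in> F; y \<in> F\<rbrakk> \<Longrightarrow> fsub x y \<in> F"
    and fmul_in: "\<lbrakk>x \<in> F; y \<in> F\<rbrakk> \<Longrightarrow> fmul x y \<in> F"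
    and fadd_error: "\<lbrakk>x \<in> F; y \<in> F\<rbrakk> \<Longrightarrow> \<bar>fadd x y - (x + y)\<bar> \<le> eps * \<bar>x + y\<bar>"
    and fsub_error: "\<lbrakk>x \<in> F; y \<in> F\<rbrakk> \<Longrightarrow> \<bar>fsub x y - (x - y)\<bar> \<le> eps * \<bar>x - y\<bar>"
    and fmul_error: "\<lbrakk>x \<in> F; y \<in> F\<rbrakk> \<Longrightarrow> \<bar>fmul x y - x * y\<bar> \<le> eps * \<bar>x * y\<bar>"

definition fl_vec :: "(real \<Rightarrow> real) \<Rightarrow> real^3 \<Rightarrow> real^3" where
  "fl_vec fl a = (\<chi> i. fl (a $ i))"

definition fp_cross ::
  "(real \<Rightarrow> real \<Rightarrow> real) \<Rightarrow> (real \<Rightarrow> real \<Rightarrow> real) \<Rightarrow> real^3 \<Rightarrow> real^3 \<Rightarrow> real^3" where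
  "fp_cross fsub fmul b c =
     vector [fsub (fmul (b$2) (c$3)) (fmul (b$3) (c$2)),
             fsub (fmul (b$3) (c$1)) (fmul (b$1) (c$3)),
             fsub (fmul (b$1) (c$2)) (fmul (b$2) (c$1))]"

definition fp_inner ::
  "(real \<Rightarrow> real \<Rightarrow> real) \<Rightarrow> (real \<Rightarrow> real \<Rightarrow> real) \<Rightarrow> real^3 \<Rightarrow> real^3 \<Rightarrow> real" where
  "fp_inner fadd fmul a v =
     fadd (fadd (fmul (a$1) (v$1)) (fmul (a$2) (v$2))) (fmul (a$3) (v$3))"

(* The entries of the columns are arbitrary reals, so they are rounded on input. *)
definition fp_triple ::
  "(real \<Rightarrow> real) \<Rightarrow> (real \<Rightarrow> real \<Rightarrow> real) \<Rightarrow> (real \<Rightarrow> real \<Rightarrow> real) \<Rightarrow> (real \<Rightarrow> real \<Rightarrow> real)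
     \<Rightarrow> real^3 \<Rightarrow> real^3 \<Rightarrow> real^3 \<Rightarrow> real" where
  "fp_triple fl fadd fsub fmul a b c =
     fp_inner fadd fmul (fl_vec fl a) (fp_cross fsub fmul (fl_vec fl b) (fl_vec fl c))"

definition triple_sigma :: "real^3^3 \<Rightarrow> real" where
  "triple_sigma A =
     \<bar>inner (column 1 A) (cross3 (column 2 A) (column 3 A))\<bar>
       / (norm (column 1 A) * norm (column 2 A) * norm (column 3 A))"

end

theory Submission
  imports Defs
begin

text \<open>
  Since \<open>\<sigma> \<le> 1\<close>, the choice \<open>K = 1\<close> forces \<open>eps \<le> 1\<close>, and
  \<open>det A / \<sigma>\<close> is the product \<open>P\<close> of the norms of the columns. Each intermediate result of the
  computation is tracked together with a bound \<open>M\<close> on the exact value, a fixed multiple of a product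
  of norms, and with a constant \<open>c\<close> such that its error is at most \<open>(c - 1) * eps * M\<close>. As
  \<open>eps \<le> 1\<close>, a rounded product turns \<open>c\<close> and \<open>d\<close> into \<open>2 * c * d\<close>, and a rounded sum or difference
  doubles \<open>c\<close>. The triple product ends with \<open>M = 6 * P\<close> and \<open>c = 256\<close>.
\<close>

text \<open>The error is measured against \<open>M\<close> and not against
  \<open>\<bar>x\<bar>\<close>, since cancellation can destroy relative accuracy. The offset in
  \<open>c - 1\<close> lets \<open>c * M\<close> bound the computed value once
  \<open>eps \<le> 1\<close>.\<close>

definition (in fp_arithmetic) approximates :: "real \<Rightarrow> real \<Rightarrow> real \<Rightarrow> real \<Rightarrow> bool" where
  "approximates c M x' x \<longleftrightarrow> x' \<in> F \<and> \<bar>x\<bar> \<le> M \<and> \<bar>x' - x\<bar> \<le> (c - 1) * eps * M"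

context fp_arithmetic
begin

lemma eps_nonneg: "0 \<le> eps"
  using fl_error[of 1] by simp

lemma approximates_mono:
  assumes "approximates c M x' x" and "c \<le> d"
  shows "approximates d M x' x"
proof -
  have "(c - 1) * eps * M \<le> (d - 1) * eps * M"
    using assms eps_nonneg by (intro mult_right_mono) (auto simp: approximates_def)
  then show ?thesis
    using assms by (auto simp: approximates_def)
qed

lemma approximates_fl:
  assumes "\<bar>x\<bar> \<le> M"
  shows "approximates 2 M (fl x) x"
  using assms fl_in fl_error[of x] mult_left_mono[OF assms eps_nonneg]
  by (auto simp: approximates_def)

lemma approximates_abs_le:
  assumes "approximates c M x' x" and "1 \<le> c" and "eps \<le> 1"
  shows "\<bar>x'\<bar> \<le> c * M"
proof -
  have "(c - 1) * eps * M \<le> (c - 1) * 1 * M"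
    using assms by (intro mult_right_mono mult_left_mono) (auto simp: approximates_def)
  then show ?thesis
    using assms by (auto simp: approximates_def algebra_simps)
qed

text \<open>Here \<open>z\<close> is the exact result of an operation on already perturbed operands.
  Rounding it adds at most \<open>eps * (c * M)\<close> to the inherited error, and
  \<open>c + (c - 1) = 2 * c - 1\<close>.\<close>

lemma approximates_round:
  assumes "z' \<in> F" and "\<bar>z' - z\<bar> \<le> eps * \<bar>z\<bar>"
    and "\<bar>z\<bar> \<le> c * M" and "\<bar>x\<bar> \<le> M" and "\<bar>z - x\<bar> \<le> (c - 1) * eps * M"
  shows "approximates (2 * c) M z' x"
proof -
  have "eps * \<bar>z\<bar> \<le> eps * (c * M)"
    using assms(3) eps_nonneg by (rule mult_left_mono)
  then have "\<bar>z' - x\<bar> \<le> eps * (c * M) + (c - 1) * eps * M"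
    using assms by linarith
  then show ?thesis
    using assms by (auto simp: approximates_def algebra_simps)
qed

lemma approximates_fmul:
  assumes x: "approximates c M x' x" and y: "approximates d N y' y"
    and "1 \<le> c" "1 \<le> d" and "eps \<le> 1"
  shows "approximates (2 * (c * d)) (M * N) (fmul x' y') (x * y)"
proof (rule approximates_round)
  have M: "0 \<le> M" "\<bar>x\<bar> \<le> M" and N: "0 \<le> N" "\<bar>y\<bar> \<le> N"
    using x y by (auto simp: approximates_def)
  have x': "\<bar>x'\<bar> \<le> c * M" and y': "\<bar>y'\<bar> \<le> d * N"
    using approximates_abs_le assms by blast+
  show "fmul x' y' \<in> F" "\<bar>fmul x' y' - x' * y'\<bar> \<le> eps * \<bar>x' * y'\<bar>"
    using x y by (auto simp: approximates_def fmul_in fmul_error)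
  have "\<bar>x'\<bar> * \<bar>y'\<bar> \<le> (c * M) * (d * N)"
    using x' y' by (intro mult_mono) auto
  then show "\<bar>x' * y'\<bar> \<le> c * d * (M * N)"
    by (simp add: abs_mult mult_ac)
  show "\<bar>x * y\<bar> \<le> M * N"
    using M N by (auto simp: abs_mult intro: mult_mono)
  have "\<bar>x' - x\<bar> * \<bar>y'\<bar> \<le> ((c - 1) * eps * M) * (d * N)"
    using x y' by (intro mult_mono) (auto simp: approximates_def)
  moreover have "\<bar>x\<bar> * \<bar>y' - y\<bar> \<le> M * ((d - 1) * eps * N)"
    using y M by (intro mult_mono) (auto simp: approximates_def)
  \<comment> \<open>Pairing one error with the computed \<open>y'\<close> and the other with the
    exact \<open>x\<close> makes the constants telescope:
    \<open>(c - 1) * d + (d - 1) = c * d - 1\<close>.\<close>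
  moreover have "x' * y' - x * y = (x' - x) * y' + x * (y' - y)"
    by (simp add: algebra_simps)
  then have "\<bar>x' * y' - x * y\<bar> \<le> \<bar>x' - x\<bar> * \<bar>y'\<bar> + \<bar>x\<bar> * \<bar>y' - y\<bar>"
    by (metis abs_mult abs_triangle_ineq)
  ultimately show "\<bar>x' * y' - x * y\<bar> \<le> (c * d - 1) * eps * (M * N)"
    by (simp add: algebra_simps)
qed

lemma approximates_fadd:
  assumes "approximates c M x' x" and "approximates c N y' y" and "1 \<le> c" and "eps \<le> 1"
  shows "approximates (2 * c) (M + N) (fadd x' y') (x + y)"
proof (rule approximates_round)
  show "\<bar>x' + y'\<bar> \<le> c * (M + N)"
    using assms(1,2)[THEN approximates_abs_le] assms(3,4)
    by (auto simp: distrib_left)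
qed (use assms in \<open>auto simp: approximates_def fadd_in fadd_error distrib_left\<close>)

lemma approximates_fsub:
  assumes "approximates c M x' x" and "approximates c N y' y" and "1 \<le> c" and "eps \<le> 1"
  shows "approximates (2 * c) (M + N) (fsub x' y') (x - y)"
proof (rule approximates_round)
  show "\<bar>x' - y'\<bar> \<le> c * (M + N)"
    using assms(1,2)[THEN approximates_abs_le] assms(3,4)
    by (auto simp: distrib_left)
qed (use assms in \<open>auto simp: approximates_def fsub_in fsub_error distrib_left\<close>)

lemma approximates_fl_vec: "approximates 2 (norm a) (fl_vec fl a $ i) (a $ i)"
  using approximates_fl[OF component_le_norm_cart] by (simp add: fl_vec_def)

lemma approximates_fp_cross:
  assumes "eps \<le> 1"
  shows "approximates 16 (2 * (norm b * norm c))
    (fp_cross fsub fmul (fl_vec fl b) (fl_vec fl c) $ i) (cross3 b c $ i)"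
proof -
  have m: "approximates 8 (norm b * norm c) (fmul (fl_vec fl b $ j) (fl_vec fl c $ k)) (b $ j * c $ k)"
    for j k
    using approximates_fmul[OF approximates_fl_vec approximates_fl_vec] assms by simp
  \<comment> \<open>The three components are the cases \<open>(2,3)\<close>, \<open>(3,1)\<close>
    and \<open>(1,2)\<close> of \<open>(j,k)\<close>.\<close>
  have "approximates 16 (2 * (norm b * norm c))
      (fsub (fmul (fl_vec fl b $ j) (fl_vec fl c $ k)) (fmul (fl_vec fl b $ k) (fl_vec fl c $ j)))
      (b $ j * c $ k - b $ k * c $ j)" for j k
    using approximates_fsub[OF m[of j k] m[of k j]] assms by (simp add: mult.commute)
  then show ?thesis
    using exhaust_3[of i] by (auto simp: fp_cross_def cross3_def)
qed

lemma approximates_fp_triple: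
  assumes "eps \<le> 1"
  shows "approximates 256 (6 * (norm a * norm b * norm c))
    (fp_triple fl fadd fsub fmul a b c) (inner a (cross3 b c))"
proof -
  let ?v = "fp_cross fsub fmul (fl_vec fl b) (fl_vec fl c)"
  define P where "P = norm a * norm b * norm c"
  \<comment> \<open>The constant is \<open>2 * (2 * 16)\<close>: rounded input times computed cross
    product.\<close>
  have m: "approximates 64 (2 * P) (fmul (fl_vec fl a $ i) (?v $ i)) (a $ i * cross3 b c $ i)" for i
    using approximates_fmul[OF approximates_fl_vec[of a i] approximates_fp_cross[of b c i]] assms
    by (simp add: P_def mult_ac)
  have "approximates 128 (4 * P)
      (fadd (fmul (fl_vec fl a $ 1) (?v $ 1)) (fmul (fl_vec fl a $ 2) (?v $ 2)))
      (a $ 1 * cross3 b c $ 1 + a $ 2 * cross3 b c $ 2)"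
    using approximates_fadd[OF m[of 1] m[of 2]] assms by simp
  \<comment> \<open>Both summands must carry the same constant, so the last product is weakened from
    64 to 128.\<close>
  from approximates_fadd[OF this approximates_mono[OF m[of 3]]] show ?thesis
    using assms by (simp add: P_def fp_triple_def fp_inner_def inner_vec_def sum_3 mult.assoc)
qed

end

text \<open>Lagrange's identity bounds the norm of the cross product, and Cauchy-Schwarz does the
  rest. This is what gives \<open>\<sigma> \<le> 1\<close>.\<close>

lemma abs_inner_cross3_le:
  "\<bar>inner a (cross3 b c)\<bar> \<le> norm a * norm b * norm c"
proof -
  have "(norm (cross3 b c))\<^sup>2 \<le> (norm b * norm c)\<^sup>2"
    using norm_cross_dot[of b c] zero_le_power2[of "inner b c"] by linarith
  then have "norm (cross3 b c) \<le> norm b * norm c"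
    by (rule power2_le_imp_le) simp
  then have "norm a * norm (cross3 b c) \<le> norm a * (norm b * norm c)"
    by (rule mult_left_mono) simp
  then show ?thesis
    using Cauchy_Schwarz_ineq2[of a "cross3 b c"] by (simp add: mult.assoc)
qed

lemma det_eq_inner_cross3:
  "det A = inner (column 1 A) (cross3 (column 2 A) (column 3 A))" for A :: "real^3^3"
  by (simp add: cross3_simps column_def)

theorem theorem5:
  shows "\<exists>K>0. \<exists>C>0.
    \<forall>(eps::real) (F::real set) fl fadd fsub fmul (A::real^3^3).
      fp_arithmetic eps F fl fadd fsub fmul \<longrightarrow>
      det A > 0 \<longrightarrow>
      triple_sigma A \<ge> K * eps \<longrightarrow>
      \<bar>inner (column 1 A) (cross3 (column 2 A) (column 3 A))
        - fp_triple fl fadd fsub fmul (column 1 A) (column 2 A) (column 3 A)\<bar>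
      \<le> C * (det A / triple_sigma A) * eps"
proof -
  \<comment> \<open>The constant 1530 is \<open>(256 - 1) * 6\<close>, from
    \<open>approximates_fp_triple\<close>.\<close>
  have "\<bar>inner (column 1 A) (cross3 (column 2 A) (column 3 A))
        - fp_triple fl fadd fsub fmul (column 1 A) (column 2 A) (column 3 A)\<bar>
      \<le> 1530 * (det A / triple_sigma A) * eps"
    if fp: "fp_arithmetic eps F fl fadd fsub fmul" and det: "det A > 0"
      and sigma: "triple_sigma A \<ge> 1 * eps"
    for eps F fl fadd fsub fmul and A :: "real^3^3"
  proof -
    interpret fp_arithmetic eps F fl fadd fsub fmul by (fact fp)
    let ?P = "norm (column 1 A) * norm (column 2 A) * norm (column 3 A)"
    have sig: "triple_sigma A = det A / ?P"
      using det by (simp add: triple_sigma_def det_eq_inner_cross3)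
    have le: "det A \<le> ?P"
      using abs_inner_cross3_le[of "column 1 A" "column 2 A" "column 3 A"] det
      by (simp add: det_eq_inner_cross3)
    then have "triple_sigma A \<le> 1"
      using det by (simp add: sig)
    then have "eps \<le> 1"
      using sigma by simp
    from approximates_fp_triple[OF this, of "column 1 A" "column 2 A" "column 3 A"]
    have "\<bar>inner (column 1 A) (cross3 (column 2 A) (column 3 A))
        - fp_triple fl fadd fsub fmul (column 1 A) (column 2 A) (column 3 A)\<bar> \<le> 1530 * ?P * eps"
      by (simp add: approximates_def abs_minus_commute mult_ac)
    moreover have "det A / triple_sigma A = ?P"
      using det by (simp add: sig)
    ultimately show ?thesis by simp
  qed
  then show ?thesis
    by (intro exI[of _ "1::real"] exI[of _ "1530::real"] conjI) (simp, simp, blast)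
qed

end
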